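(* Let $d\ge 2$ be fixed. In the online bipartite hypergraph secretary matching problem (setting in the context), the matching $\mu$ returned by Algorithm HG satisfies $$\mathbb{E}[w(\mu)]\ \ge\ (1-o(1))\,\frac{1}{d^{\frac{d}{d-1}}}\; w(\mu^* ),$$ where $\mu^*$ is a maximum weight matching of $H$ and $o(1)\to 0$ as $m=|L|\to\infty$; i.e., the algorithm has competitive ratio $1/d^{\frac{d}{d-1}}$ (asymptotically in $m$).
   Context: Setting (online bipartite hypergraph secretary matching): $H=(L\cup R,E)$ is an edge-weighted hypergraph, every hyperedge has the form $(v,S)$ with $v\in L$, $S\subseteq R$, $|S|\le d$, and nonnegative weight; $w(\mu)$ is the total weight of a set of hyperedges $\mu$. A matching is a set of hyperedges whose vertex sets $\{v\}\cup S$ are pairwise disjoint. $R$ is known in advance; the $m=|L|$ vertices of $L$ ($m$ known) arrive in a uniformly random order $\ell_1,\dots,\ell_m$; $L_t=\{\ell_1,\dots,\ell_t\}$; upon arrival of $\ell_t$ all its incident hyperedges and their weights are revealed, and the algorithm must immediately and irrevocably choose at most one of them whose $R$-vertices are all unmatched. Standing assumption: for every $L'\subseteq L$ the maximum weight matching of the sub-hypergraph $H(L'\cup R)$ (hyperedges whose $L$-vertex lies in $L'$) is unique. Let $f_d=d^{-1/(d-1)}$, and define $\alpha_t=0$ if $t\le f_d m$ and $\alpha_t=1-d\sum_{i=1}^{t-1}\frac{\alpha_i}{i}$ if $t>f_dm$. Algorithm HG: let $A=R$, $\mu=\emptyset$. For $t=\lfloor f_dm\rfloor+1,\dots,m$: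 let $\mu^*_t$ be the maximum weight matching of $H(L_t\cup R)$; let $e_t=(\ell_t,S_t)$ be the hyperedge of $\mu^*_t$ containing $\ell_t$ (with $S_t=\emptyset$ and $e_t$ a null edge of weight $0$ if $\ell_t$ is unmatched in $\mu^*_t$); let $x_t$ be the probability that $S_t\subseteq A$ at the start of round $t$, where the probability is over a uniformly random order of $L_{t-1}$ (with $\ell_t$ and the set $L_{t-1}$ fixed) and the algorithm's random choices in rounds $1,\dots,t-1$; if $S_t\subseteq A$, then with probability $\alpha_t/x_t$ add $e_t$ to $\mu$ and remove $S_t$ from $A$. Return $\mu$. *)

theory Defs
  imports "HOL-Probability.Probability" "HOL-Library.Disjoint_Sets"
begin

text \<open>
  A hyperedge is a pair \<open>(v, S)\<close> with online endpoint \<open>v\<close> and offline endpoints \<open>S\<close>. The two sides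
  have different types, so the vertex set lives in the sum type.
\<close>

type_synonym ('l, 'r) hyperedge = "'l \<times> 'r set"

definition hverts :: "('l, 'r) hyperedge \<Rightarrow> ('l + 'r) set" where
  "hverts e = insert (Inl (fst e)) (Inr ` snd e)"

definition bip_hypergraph ::
  "nat \<Rightarrow> 'l set \<Rightarrow> 'r set \<Rightarrow> ('l, 'r) hyperedge set \<Rightarrow> (('l, 'r) hyperedge \<Rightarrow> real) \<Rightarrow> bool" where
  "bip_hypergraph d L R E w \<longleftrightarrow>
     finite L \<and> finite R \<and>
     (\<forall>(v, S) \<in> E. v \<in> L \<and> S \<subseteq> R \<and> card S \<le> d) \<and>
     (\<forall>e \<in> E. 0 \<le> w e)"

definition matching :: "('l, 'r) hyperedge set \<Rightarrow> ('l, 'r) hyperedge set \<Rightarrow> bool" where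
  "matching E M \<longleftrightarrow> M \<subseteq> E \<and> disjoint_family_on hverts M"

definition weight :: "(('l, 'r) hyperedge \<Rightarrow> real) \<Rightarrow> ('l, 'r) hyperedge set \<Rightarrow> real" where
  "weight w M = (\<Sum>e\<in>M. w e)"

definition max_weight_matching ::
  "('l, 'r) hyperedge set \<Rightarrow> (('l, 'r) hyperedge \<Rightarrow> real) \<Rightarrow> ('l, 'r) hyperedge set \<Rightarrow> bool" where
  "max_weight_matching E w M \<longleftrightarrow>
     matching E M \<and> (\<forall>M'. matching E M' \<longrightarrow> weight w M' \<le> weight w M)"

text \<open>The hyperedges of \<open>H(L' \<union> R)\<close>.\<close>

definition restrict_edges :: "('l, 'r) hyperedge set \<Rightarrow> 'l set \<Rightarrow> ('l, 'r) hyperedge set" where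
  "restrict_edges E L' = {e \<in> E. fst e \<in> L'}"

definition unique_optima ::
  "'l set \<Rightarrow> ('l, 'r) hyperedge set \<Rightarrow> (('l, 'r) hyperedge \<Rightarrow> real) \<Rightarrow> bool" where
  "unique_optima L E w \<longleftrightarrow> (\<forall>L' \<subseteq> L. \<exists>!M. max_weight_matching (restrict_edges E L') w M)"

text \<open>Only meaningful under \<open>unique_optima\<close>.\<close>

definition opt_matching ::
  "('l, 'r) hyperedge set \<Rightarrow> (('l, 'r) hyperedge \<Rightarrow> real) \<Rightarrow> ('l, 'r) hyperedge set" where
  "opt_matching E w = (THE M. max_weight_matching E w M)"

text \<open>The offline endpoints of the hyperedge of the matching \<open>M\<close> at \<open>l\<close>, empty if \<open>l\<close> is unmatched.\<close>

definition partners :: "('l, 'r) hyperedge set \<Rightarrow> 'l \<Rightarrow> 'r set" where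
  "partners M l = (if \<exists>S. (l, S) \<in> M then THE S. (l, S) \<in> M else {})"

definition hg_threshold :: "nat \<Rightarrow> real" where
  "hg_threshold d = real d powr (- 1 / (real d - 1))"

function hg_alpha :: "nat \<Rightarrow> nat \<Rightarrow> nat \<Rightarrow> real" where
  "hg_alpha d m t =
     (if real t \<le> hg_threshold d * real m then 0
      else 1 - real d * (\<Sum>i = 1..<t. hg_alpha d m i / real i))"
  by pat_completeness auto
termination by (relation "Wellfounded.measure (\<lambda>(d, m, t). t)") auto

declare hg_alpha.simps [simp del]

text \<open>
  \<open>hg_rounds d m R E w t \<sigma>\<close> is the distribution of the state \<open>(A, \<mu>)\<close> after \<open>t\<close> rounds when the
  vertices arrive in the fixed order \<open>\<sigma>\<close>; the arrival of round \<open>t + 1\<close> is \<open>\<sigma> ! t\<close>, as lists are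
  indexed from \<open>0\<close>. The number \<open>x\<close> depends on the set of the first \<open>t\<close> arrivals but not on their
  order: it is computed from a run on a freshly permuted copy of that set.

  If the arriving vertex \<open>l\<close> is unmatched in \<open>M\<close>, then \<open>S = {}\<close> and the null hyperedge, which has
  weight \<open>0\<close> and is not in the hypergraph, is not recorded in \<open>\<mu>\<close>. (A hyperedge \<open>(l, {})\<close> belonging
  to \<open>E\<close> may have positive weight; it is selected only through \<open>(l, {}) \<in> M\<close>.)

  \<open>bernoulli_pmf\<close> truncates its argument to \<open>[0, 1]\<close>. The analysis gives
  \<open>0 \<le> \<alpha> \<le> x\<close> once \<open>d \<le> hg_threshold d * m\<close>; for smaller \<open>m\<close> the defining recursion can make
  \<open>\<alpha>\<close> negative, and a negative quotient is read as probability \<open>0\<close>.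
\<close>

primrec hg_rounds ::
  "nat \<Rightarrow> nat \<Rightarrow> 'r set \<Rightarrow> ('l, 'r) hyperedge set \<Rightarrow> (('l, 'r) hyperedge \<Rightarrow> real) \<Rightarrow> nat \<Rightarrow>
   'l list \<Rightarrow> ('r set \<times> ('l, 'r) hyperedge set) pmf" where
  "hg_rounds d m R E w 0 = (\<lambda>\<sigma>. return_pmf (R, {}))"
| "hg_rounds d m R E w (Suc t) = (\<lambda>\<sigma>.
     if int (Suc t) \<le> \<lfloor>hg_threshold d * real m\<rfloor> then hg_rounds d m R E w t \<sigma>
     else
       let l = \<sigma> ! t;
           M = opt_matching (restrict_edges E (set (take (Suc t) \<sigma>))) w;
           S = partners M l;
           x = measure_pmf.prob
                 (pmf_of_set (permutations_of_set (set (take t \<sigma>))) \<bind> hg_rounds d m R E w t)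
                 {(A, \<mu>). S \<subseteq> A}
       in do {
         (A, \<mu>) \<leftarrow> hg_rounds d m R E w t \<sigma>;
         if S \<subseteq> A then do {
           accept \<leftarrow> bernoulli_pmf (hg_alpha d m (Suc t) / x);
           return_pmf
             (if accept then (A - S, if (l, S) \<in> M then insert (l, S) \<mu> else \<mu>) else (A, \<mu>))
         }
         else return_pmf (A, \<mu>)
       })"

definition hg ::
  "nat \<Rightarrow> 'l set \<Rightarrow> 'r set \<Rightarrow> ('l, 'r) hyperedge set \<Rightarrow> (('l, 'r) hyperedge \<Rightarrow> real) \<Rightarrow>
   ('l, 'r) hyperedge set pmf" where
  "hg d L R E w = do {
     \<sigma> \<leftarrow> pmf_of_set (permutations_of_set L);
     (A, \<mu>) \<leftarrow> hg_rounds d (card L) R E w (card L) \<sigma>;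
     return_pmf \<mu>
   }"

lemma opt_matching_props:
  assumes "unique_optima L E w" "L' \<subseteq> L"
  shows "max_weight_matching (restrict_edges E L') w (opt_matching (restrict_edges E L') w)"
  unfolding opt_matching_def
  by (rule theI') (use assms in \<open>auto simp: unique_optima_def\<close>)

lemma hg_rounds_matching:
  assumes H: "bip_hypergraph d L R E w" and U: "unique_optima L E w"
    and \<sigma>: "distinct \<sigma>" "set \<sigma> = L"
    and "t \<le> length \<sigma>" "(A, \<mu>) \<in> set_pmf (hg_rounds d m R E w t \<sigma>)"
  shows "matching (restrict_edges E (set (take t \<sigma>))) \<mu> \<and> A = R - (\<Union>e\<in>\<mu>. snd e)"
  using assms(5,6)
proof (induction t arbitrary: A \<mu>)
  case 0
  then show ?case by (auto simp: matching_def disjoint_family_on_def)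
next
  case (Suc t)
  define M where "M = opt_matching (restrict_edges E (set (take (Suc t) \<sigma>))) w"
  define l where "l = \<sigma> ! t"
  define S where "S = partners M l"
  have take: "set (take (Suc t) \<sigma>) = insert l (set (take t \<sigma>))"
    using Suc.prems by (simp add: take_Suc_conv_app_nth l_def)
  have l: "l \<notin> set (take t \<sigma>)"
    using Suc.prems \<sigma>(1) by (auto simp: l_def in_set_conv_nth nth_eq_iff_index_eq)
  have MM: "matching (restrict_edges E (set (take (Suc t) \<sigma>))) M"
    using opt_matching_props[OF U, of "set (take (Suc t) \<sigma>)"] \<sigma>(2)
    by (auto simp: M_def max_weight_matching_def dest: in_set_takeD)
  have mono: "matching (restrict_edges E (set (take (Suc t) \<sigma>))) \<nu>"
    if "matching (restrict_edges E (set (take t \<sigma>))) \<nu>" for \<nu>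
    using that by (auto simp: matching_def restrict_edges_def take)
  obtain A0 \<mu>0 where prev: "(A0, \<mu>0) \<in> set_pmf (hg_rounds d m R E w t \<sigma>)"
    and step: "(A, \<mu>) = (A0, \<mu>0) \<or>
      S \<subseteq> A0 \<and> A = A0 - S \<and> \<mu> = (if (l, S) \<in> M then insert (l, S) \<mu>0 else \<mu>0)"
  proof (cases "int (Suc t) \<le> \<lfloor>hg_threshold d * real m\<rfloor>")
    case True
    with Suc.prems(2) that show ?thesis by simp
  next
    case False
    define F where "F = (\<lambda>s. (fst s - S, if (l, S) \<in> M then insert (l, S) (snd s) else snd s))"
    from False obtain p where "hg_rounds d m R E w (Suc t) \<sigma> =
      hg_rounds d m R E w t \<sigma> \<bind> (\<lambda>s. if S \<subseteq> fst s
        then bernoulli_pmf p \<bind> (\<lambda>b. return_pmf (if b then F s else s)) else return_pmf s)"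
      unfolding hg_rounds.simps Let_def case_prod_beta F_def M_def l_def S_def prod.collapse
      by (simp only: if_False)
    with Suc.prems(2) obtain s where s: "s \<in> set_pmf (hg_rounds d m R E w t \<sigma>)"
      "(A, \<mu>) \<in> set_pmf (if S \<subseteq> fst s
        then bernoulli_pmf p \<bind> (\<lambda>b. return_pmf (if b then F s else s)) else return_pmf s)"
      by (auto simp only: set_bind_pmf)
    from s(2) have "(A, \<mu>) = s \<or> S \<subseteq> fst s \<and> (A, \<mu>) = F s"
      by (cases "S \<subseteq> fst s") (auto simp only: set_bind_pmf set_return_pmf if_True if_False split: if_splits)
    with s(1) that[of "fst s" "snd s"] show ?thesis
      unfolding F_def prod.collapse by blast
  qed
  have IH: "matching (restrict_edges E (set (take t \<sigma>))) \<mu>0" "A0 = R - (\<Union>e\<in>\<mu>0. snd e)"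
    using Suc.IH[OF _ prev] Suc.prems(1) by auto
  show ?case
  proof (cases "(A, \<mu>) = (A0, \<mu>0)")
    case True
    then show ?thesis using IH mono by auto
  next
    case False
    with step have st: "S \<subseteq> A0" "A = A0 - S" "\<mu> = (if (l, S) \<in> M then insert (l, S) \<mu>0 else \<mu>0)"
      by blast+
    show ?thesis
    proof (cases "(l, S) \<in> M")
      case True
      have "hverts (l, S) \<inter> hverts e = {}" if "e \<in> \<mu>0" for e
      proof -
        have "fst e \<noteq> l"
          using that IH(1) l by (auto simp: matching_def restrict_edges_def)
        moreover have "S \<inter> snd e = {}"
          using that st(1) IH(2) by blast
        ultimately show ?thesis by (auto simp: hverts_def)
      qed
      with IH(1) have "disjoint_family_on hverts (insert (l, S) \<mu>0)"
        by (simp add: matching_def disjoint_family_on_def Int_commute)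
      moreover have "(l, S) \<in> restrict_edges E (set (take (Suc t) \<sigma>))"
        using True MM by (auto simp: matching_def)
      ultimately show ?thesis
        using True st IH mono[OF IH(1)] by (auto simp: matching_def)
    next
      case nM: False
      have "S = {}"
      proof (rule ccontr)
        assume "S \<noteq> {}"
        then obtain S' where S': "(l, S') \<in> M" by (auto simp: S_def partners_def split: if_splits)
        have "S'' = S'" if "(l, S'') \<in> M" for S''
        proof (rule ccontr)
          assume "S'' \<noteq> S'"
          with MM S' that have "hverts (l, S'') \<inter> hverts (l, S') = {}"
            unfolding matching_def disjoint_family_on_def by blast
          then show False by (simp add: hverts_def)
        qed
        with S' have "(THE S. (l, S) \<in> M) = S'" by (intro the_equality)
        moreover have "S = (THE S. (l, S) \<in> M)"
          unfolding S_def partners_def using S' by metis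
        ultimately have "S = S'" by simp
        with S' nM show False by simp
      qed
      then show ?thesis using nM st IH mono by auto
    qed
  qed
qed

lemma hg_matching:
  assumes "bip_hypergraph d L R E w" "unique_optima L E w" "\<mu> \<in> set_pmf (hg d L R E w)"
  shows "matching E \<mu>"
proof -
  have "finite L" using assms(1) by (simp add: bip_hypergraph_def)
  with assms(3) obtain \<sigma> A where \<sigma>: "\<sigma> \<in> permutations_of_set L"
    "(A, \<mu>) \<in> set_pmf (hg_rounds d (card L) R E w (card L) \<sigma>)"
    by (auto simp: hg_def set_bind_pmf)
  have "distinct \<sigma>" "set \<sigma> = L" using \<sigma>(1) by (auto simp: permutations_of_set_def)
  moreover from this have "card L \<le> length \<sigma>" by (auto simp: card_length)
  ultimately show ?thesis
    using hg_rounds_matching[OF assms(1,2), of \<sigma> "card L" A \<mu> "card L"] \<sigma>(2)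
    by (auto simp: matching_def restrict_edges_def)
qed

end

theory Submission
  imports Defs "HOL-Real_Asymp.Real_Asymp"
begin

text \<open>
  A uniformly random order of a \<open>(t + 1)\<close>-set \<open>L'\<close> is a uniform last vertex \<open>l\<close> preceded by a
  uniformly random order of \<open>L' - {l}\<close>. Given \<open>l\<close>, the last hyperedge is fixed and is selected with
  probability exactly \<open>\<alpha>\<^sub>t\<^sub>+\<^sub>1\<close>, provided \<open>\<alpha>\<^sub>t\<^sub>+\<^sub>1 \<le> x\<close>. This allows an induction over \<open>t\<close> for all
  sets of \<open>t\<close> arrivals at once. As the optimum covers an offline vertex at most once,
  an offline vertex is occupied after \<open>t\<close> rounds with probability at most
  \<open>\<Sum>i\<le>t. \<alpha>\<^sub>i / i\<close>; a union bound over at most \<open>d\<close> vertices then gives \<open>\<alpha>\<^sub>t\<^sub>+\<^sub>1 \<le> x\<close>. Deleting a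
  random vertex from \<open>L'\<close> costs at most a \<open>1 / (t + 1)\<close> fraction of the optimum on average, so the
  expected weight after \<open>t\<close> rounds is at least \<open>(\<Sum>i\<le>t. \<alpha>\<^sub>i) / t\<close> times the optimum of the \<open>t\<close>
  arrivals. Finally \<open>\<alpha>\<^sub>t\<^sub>+\<^sub>1 = \<alpha>\<^sub>t (1 - d / t)\<close> makes \<open>(d - 1) \<alpha>\<^sub>t\<close> a telescoping
  difference of the terms \<open>(t - 1) \<alpha>\<^sub>t\<close>, and \<open>(1 - 1 / (t + 1))\<^sup>d \<ge> 1 - d / t\<close> bounds the last one.
\<close>

section \<open>The threshold and the acceptance probabilities\<close>

lemma hg_threshold_pos: "d \<ge> 2 \<Longrightarrow> 0 < hg_threshold d"
  by (simp add: hg_threshold_def)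

lemma hg_threshold_less_1: "d \<ge> 2 \<Longrightarrow> hg_threshold d < 1"
  unfolding hg_threshold_def by (subst powr_less_one) auto

text \<open>\<open>f = hg_threshold d\<close> solves \<open>d * f ^ (d - 1) = 1\<close>. It is thus
  the critical point of \<open>(f - f ^ d) / (d - 1)\<close>, the limiting ratio for a threshold
  \<open>f\<close>.\<close>

lemma hg_threshold_power:
  assumes "d \<ge> 2"
  shows "hg_threshold d ^ d = hg_threshold d / real d"
proof -
  have "hg_threshold d ^ d = hg_threshold d powr real d"
    using hg_threshold_pos[OF assms] by (simp add: powr_realpow)
  also have "\<dots> = real d powr (- 1 / (real d - 1) * real d)"
    by (simp add: hg_threshold_def powr_powr)
  also have "- 1 / (real d - 1) * real d = - 1 / (real d - 1) - 1"
    using assms by (simp add: field_simps)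
  also have "real d powr \<dots> = hg_threshold d / real d"
    using assms by (simp only: powr_diff hg_threshold_def) simp
  finally show ?thesis .
qed

lemma hg_ratio_eq:
  assumes "d \<ge> 2"
  shows "1 / real d powr (real d / (real d - 1)) = hg_threshold d / real d"
proof -
  have "real d / (real d - 1) = 1 / (real d - 1) + 1"
    using assms by (simp add: field_simps)
  then have "real d powr (real d / (real d - 1)) = real d powr (1 / (real d - 1)) * real d"
    using assms by (simp add: powr_add)
  then show ?thesis
    by (simp add: hg_threshold_def powr_minus_divide)
qed

lemma hg_alpha_early: "real t \<le> hg_threshold d * real m \<Longrightarrow> hg_alpha d m t = 0"
  by (subst hg_alpha.simps) simp

lemma hg_alpha_late:
  "hg_threshold d * real m < real t \<Longrightarrow>
     hg_alpha d m t = 1 - real d * (\<Sum>i = 1..<t. hg_alpha d m i / real i)"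
  by (subst hg_alpha.simps) simp

text \<open>Subtracting consecutive instances of the recursion turns the sum over all earlier rounds
  into a single factor.\<close>

lemma hg_alpha_Suc:
  assumes "hg_threshold d * real m < real t"
  shows "hg_alpha d m (Suc t) = hg_alpha d m t * (1 - real d / real t)"
proof (cases "t = 0")
  case True
  then show ?thesis
    using assms by (simp add: hg_alpha_late[of d m 0] hg_alpha_late[of d m "Suc 0"])
next
  case False
  then have "(\<Sum>i = 1..<Suc t. hg_alpha d m i / real i) =
      (\<Sum>i = 1..<t. hg_alpha d m i / real i) + hg_alpha d m t / real t"
    by simp
  moreover have "hg_threshold d * real m < real (Suc t)"
    using assms by simp
  ultimately show ?thesis
    using hg_alpha_late[OF assms] hg_alpha_late[of d m "Suc t"] False
    by (simp add: algebra_simps del: of_nat_Suc)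
qed

text \<open>Length of the sampling phase, in which nothing is accepted. As a natural number it can
  serve as the base of inductions.\<close>

definition hg_start :: "nat \<Rightarrow> nat \<Rightarrow> nat" where
  "hg_start d m = nat \<lfloor>hg_threshold d * real m\<rfloor>"

lemma le_hg_start_iff: "t \<le> hg_start d m \<longleftrightarrow> real t \<le> hg_threshold d * real m"
proof -
  have "0 \<le> hg_threshold d * real m"
    by (simp add: hg_threshold_def)
  then show ?thesis
    unfolding hg_start_def by (simp add: le_nat_iff le_floor_iff)
qed

lemma hg_start_less_iff: "hg_start d m < t \<longleftrightarrow> hg_threshold d * real m < real t"
  using le_hg_start_iff[of t d m] by linarith

lemma hg_alpha_first: "hg_alpha d m (Suc (hg_start d m)) = 1"
proof -
  have "hg_threshold d * real m < real (Suc (hg_start d m))"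
    by (subst hg_start_less_iff[symmetric]) simp
  then have "hg_alpha d m (Suc (hg_start d m)) =
      1 - real d * (\<Sum>i = 1..<Suc (hg_start d m). hg_alpha d m i / real i)"
    by (rule hg_alpha_late)
  also have "(\<Sum>i = 1..<Suc (hg_start d m). hg_alpha d m i / real i) = 0"
    by (intro sum.neutral) (auto simp: hg_alpha_early less_Suc_eq_le le_hg_start_iff)
  finally show ?thesis by simp
qed

text \<open>After the sampling phase \<open>t\<close> exceeds \<open>hg_threshold d * m\<close>,
  hence \<open>d\<close>, so no factor \<open>1 - d / t\<close> is negative. This is where
  \<open>m\<close> has to be large.\<close>

lemma hg_alpha_nonneg:
  assumes "real d \<le> hg_threshold d * real m"
  shows "0 \<le> hg_alpha d m t"
proof (induction t)
  case 0
  show ?case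
    using assms by (simp add: hg_alpha_early)
next
  case (Suc t)
  consider "Suc t \<le> hg_start d m" | "t = hg_start d m" | "hg_start d m < t"
    by linarith
  then show ?case
  proof cases
    case 1
    then show ?thesis by (simp add: le_hg_start_iff hg_alpha_early del: of_nat_Suc)
  next
    case 2
    then show ?thesis by (simp add: hg_alpha_first)
  next
    case 3
    then have *: "hg_threshold d * real m < real t"
      by (simp add: hg_start_less_iff)
    then have "real d / real t \<le> 1"
      using assms by (simp add: divide_le_eq)
    then show ?thesis
      using Suc hg_alpha_Suc[OF *] by simp
  qed
qed

lemma hg_alpha_upper:
  assumes "real d \<le> hg_threshold d * real m" "hg_start d m < t"
  shows "hg_alpha d m t \<le> (real (Suc (hg_start d m)) / real t) ^ d"
proof -
  have "Suc (hg_start d m) \<le> t"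
    using assms(2) by simp
  then show ?thesis
  proof (induction t rule: dec_induct)
    case base
    show ?case by (simp add: hg_alpha_first)
  next
    case (step t)
    then have t: "hg_threshold d * real m < real t" "0 < t"
      by (auto simp flip: hg_start_less_iff)
    \<comment> \<open>Weakening \<open>t\<close> to \<open>t + 1\<close> in the denominator allows
      Bernoulli with base \<open>t / (t + 1)\<close>, whose \<open>d\<close>-th powers
      telescope.\<close>
    have "1 - real d / real t \<le> 1 + real d * (- 1 / real (Suc t))"
      using t(2) by (simp add: field_simps)
    also have "\<dots> \<le> (1 + - 1 / real (Suc t)) ^ d"
      by (rule Bernoulli_inequality) (simp add: field_simps)
    also have "1 + - 1 / real (Suc t) = real t / real (Suc t)"
      by (simp add: field_simps)
    finally have le: "1 - real d / real t \<le> (real t / real (Suc t)) ^ d" .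
    have "hg_alpha d m (Suc t) = hg_alpha d m t * (1 - real d / real t)"
      by (rule hg_alpha_Suc[OF t(1)])
    also have "\<dots> \<le> hg_alpha d m t * (real t / real (Suc t)) ^ d"
      by (intro mult_left_mono le hg_alpha_nonneg assms(1))
    also have "\<dots> \<le> (real (Suc (hg_start d m)) / real t) ^ d * (real t / real (Suc t)) ^ d"
      by (intro mult_right_mono step.IH) simp
    also have "\<dots> = (real (Suc (hg_start d m)) / real (Suc t)) ^ d"
      using t(2) by (simp flip: power_mult_distrib)
    finally show ?case .
  qed
qed

text \<open>By \<open>hg_alpha_Suc\<close>, \<open>(d - 1) * \<alpha>\<^sub>s = (s - 1) *
  \<alpha>\<^sub>s - s * \<alpha>\<^sub>s\<^sub>+\<^sub>1\<close> after the sampling phase. The sum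
  telescopes, starting from the first nonzero value, which is 1.\<close>

lemma sum_hg_alpha:
  assumes "hg_start d m \<le> n"
  shows "(real d - 1) * (\<Sum>i = 1..n. hg_alpha d m i) =
    real (hg_start d m) - real n * hg_alpha d m (Suc n)"
  using assms
proof (induction n rule: dec_induct)
  case base
  have "(\<Sum>i = 1..hg_start d m. hg_alpha d m i) = 0"
    by (intro sum.neutral) (auto simp: hg_alpha_early le_hg_start_iff)
  then show ?case by (simp add: hg_alpha_first)
next
  case (step n)
  then have "hg_threshold d * real m < real (Suc n)"
    by (simp flip: hg_start_less_iff del: of_nat_Suc)
  from hg_alpha_Suc[OF this] have "real (Suc n) * hg_alpha d m (Suc (Suc n)) =
      hg_alpha d m (Suc n) * (real (Suc n) - real d)"
    by (simp add: field_simps)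
  with step.IH show ?case
    by (simp add: algebra_simps)
qed

section \<open>The ratio for finite \<open>m\<close> and its limit\<close>

definition hg_guarantee :: "nat \<Rightarrow> nat \<Rightarrow> real" where
  "hg_guarantee d m =
     (real (hg_start d m) - real m * (real (Suc (hg_start d m)) / real (Suc m)) ^ d) /
     ((real d - 1) * real m)"

text \<open>Bounding the last term of the telescoped sum by \<open>hg_alpha_upper\<close> leaves an
  explicit expression, free of the recursion.\<close>

lemma hg_guarantee_le:
  assumes "d \<ge> 2" "real d \<le> hg_threshold d * real m"
  shows "hg_guarantee d m \<le> (\<Sum>i = 1..m. hg_alpha d m i) / real m"
proof -
  have start: "hg_start d m \<le> m"
  proof -
    have "real (hg_start d m) \<le> hg_threshold d * real m"
      by (simp flip: le_hg_start_iff)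
    also have "\<dots> \<le> real m"
      using hg_threshold_less_1[OF assms(1)] hg_threshold_pos[OF assms(1)]
      by (intro mult_left_le_one_le) auto
    finally show ?thesis by simp
  qed
  have m: "0 < m"
    using assms by (cases m) auto
  have "hg_alpha d m (Suc m) \<le> (real (Suc (hg_start d m)) / real (Suc m)) ^ d"
    using start by (intro hg_alpha_upper assms(2)) simp
  then have "real m * hg_alpha d m (Suc m) \<le>
      real m * (real (Suc (hg_start d m)) / real (Suc m)) ^ d"
    by (intro mult_left_mono) auto
  then have "real (hg_start d m) - real m * (real (Suc (hg_start d m)) / real (Suc m)) ^ d \<le>
      (real d - 1) * (\<Sum>i = 1..m. hg_alpha d m i)"
    unfolding sum_hg_alpha[OF start] by linarith
  then have "hg_guarantee d m \<le>
      ((real d - 1) * (\<Sum>i = 1..m. hg_alpha d m i)) / ((real d - 1) * real m)"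
    unfolding hg_guarantee_def using assms(1) m by (intro divide_right_mono) auto
  then show ?thesis
    using assms(1) by simp
qed

text \<open>Both quotients tend to the threshold \<open>f\<close>, so the limit is
  \<open>(f - f ^ d) / (d - 1)\<close>, which equals \<open>f / d\<close> by
  \<open>hg_threshold_power\<close>.\<close>

lemma hg_guarantee_tendsto:
  assumes "d \<ge> 2"
  shows "hg_guarantee d \<longlonglongrightarrow> hg_threshold d / real d"
proof -
  define f where "f = hg_threshold d"
  have f: "0 < f"
    using hg_threshold_pos[OF assms] by (simp add: f_def)
  have start: "real (hg_start d m) = real_of_int \<lfloor>f * real m\<rfloor>" for m
    using f by (simp add: hg_start_def f_def)
  have 1: "(\<lambda>m. real (hg_start d m) / real m) \<longlonglongrightarrow> f"
    unfolding start using f by real_asymp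
  have 2: "(\<lambda>m. real (Suc (hg_start d m)) / real (Suc m)) \<longlonglongrightarrow> f"
    unfolding of_nat_Suc start using f by real_asymp
  have "(\<lambda>m. (real (hg_start d m) / real m - (real (Suc (hg_start d m)) / real (Suc m)) ^ d) /
      (real d - 1)) \<longlonglongrightarrow> (f - f ^ d) / (real d - 1)"
    using assms by (intro tendsto_intros 1 2) auto
  then have "hg_guarantee d \<longlonglongrightarrow> (f - f ^ d) / (real d - 1)"
  proof (rule Lim_transform_eventually)
    show "\<forall>\<^sub>F m in sequentially.
      (real (hg_start d m) / real m - (real (Suc (hg_start d m)) / real (Suc m)) ^ d) /
      (real d - 1) = hg_guarantee d m"
      using eventually_gt_at_top[of 0]
    proof eventually_elim
      case (elim m)
      then have "real (hg_start d m) / real m - (real (Suc (hg_start d m)) / real (Suc m)) ^ d =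
          (real (hg_start d m) - real m * (real (Suc (hg_start d m)) / real (Suc m)) ^ d) / real m"
        by (simp add: diff_divide_distrib)
      then show ?case
        by (simp only: hg_guarantee_def divide_divide_eq_left mult.commute)
    qed
  qed
  moreover have "(f - f ^ d) / (real d - 1) = f / real d"
    unfolding f_def hg_threshold_power[OF assms] using assms by (simp add: field_simps)
  ultimately show ?thesis
    by (simp add: f_def)
qed

section \<open>The hyperedges of a matching, indexed by online vertices\<close>

lemma matching_partners:
  assumes "matching E M" "(l, S) \<in> M"
  shows "partners M l = S"
proof -
  have "S' = S" if "(l, S') \<in> M" for S'
  proof (rule ccontr)
    assume "S' \<noteq> S"
    with assms that have "hverts (l, S') \<inter> hverts (l, S) = {}"
      unfolding matching_def disjoint_family_on_def by blast
    then show False by (simp add: hverts_def)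
  qed
  with assms(2) have "(THE S. (l, S) \<in> M) = S"
    by (intro the_equality)
  with assms(2) show ?thesis
    unfolding partners_def by (subst if_P) auto
qed

text \<open>Some \<open>r\<close> is required, since an unmatched \<open>l\<close> also has the
  value \<open>{}\<close>.\<close>

lemma in_partnersD:
  assumes "matching E M" "r \<in> partners M l"
  shows "(l, partners M l) \<in> M"
proof -
  obtain S where "(l, S) \<in> M"
    using assms(2) by (auto simp: partners_def split: if_splits)
  with matching_partners[OF assms(1) this] show ?thesis by simp
qed

lemma partners_disjoint:
  assumes "matching E M" "r \<in> partners M l" "r \<in> partners M l'"
  shows "l = l'"
proof (rule ccontr)
  assume "l \<noteq> l'"
  then have "hverts (l, partners M l) \<inter> hverts (l', partners M l') = {}"
    using assms(1) in_partnersD[OF assms(1,2)] in_partnersD[OF assms(1,3)]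
    unfolding matching_def disjoint_family_on_def by blast
  then show False
    using assms(2,3) by (auto simp: hverts_def)
qed

text \<open>Testing membership in \<open>M\<close> separates the null hyperedge, of weight 0, from a
  genuine hyperedge \<open>(l, {})\<close>, which may have positive weight.\<close>

definition edge_weight ::
  "(('l, 'r) hyperedge \<Rightarrow> real) \<Rightarrow> ('l, 'r) hyperedge set \<Rightarrow> 'l \<Rightarrow> real" where
  "edge_weight w M l = (if (l, partners M l) \<in> M then w (l, partners M l) else 0)"

lemma sum_edge_weight:
  assumes "finite L" "matching (restrict_edges E L) M"
  shows "(\<Sum>l\<in>L. edge_weight w M l) = weight w M"
proof -
  define K where "K = {l \<in> L. (l, partners M l) \<in> M}"
  have M: "M = (\<lambda>l. (l, partners M l)) ` K"
  proof (intro equalityI subsetI)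
    fix e assume e: "e \<in> M"
    obtain l S where [simp]: "e = (l, S)" by (cases e)
    have "l \<in> L"
      using assms(2) e by (auto simp: matching_def restrict_edges_def)
    with matching_partners[OF assms(2), of l S] e
    show "e \<in> (\<lambda>l. (l, partners M l)) ` K"
      by (auto simp: K_def)
  qed (auto simp: K_def)
  have "weight w M = (\<Sum>l\<in>K. w (l, partners M l))"
    unfolding weight_def by (subst M, subst sum.reindex) (auto simp: inj_on_def)
  also have "\<dots> = (\<Sum>l\<in>L. edge_weight w M l)"
    unfolding K_def edge_weight_def using assms(1) by (simp add: sum.If_cases Int_def)
  finally show ?thesis ..
qed

lemma weight_remove_vertex:
  assumes "finite M" "matching E M"
  shows "weight w {e \<in> M. fst e \<noteq> l} = weight w M - edge_weight w M l"
proof -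
  have M: "fst e = l \<longleftrightarrow> e = (l, partners M l)" if "e \<in> M" for e
    using that matching_partners[OF assms(2), of l "snd e"] by (metis fst_conv prod.collapse)
  show ?thesis
  proof (cases "(l, partners M l) \<in> M")
    case True
    have "{e \<in> M. fst e \<noteq> l} = M - {(l, partners M l)}"
      using M by blast
    then show ?thesis
      using True assms(1) by (simp add: weight_def edge_weight_def sum_diff1)
  next
    case False
    with M have "fst e \<noteq> l" if "e \<in> M" for e
      using that by metis
    then have "{e \<in> M. fst e \<noteq> l} = M"
      by blast
    then show ?thesis
      using False by (simp add: edge_weight_def)
  qed
qed

section \<open>The last arrival and a single round\<close>

lemma random_permutation_of_set_snoc:
  assumes "finite A" "A \<noteq> {}"
  shows "pmf_of_set (permutations_of_set A) =
    do {x \<leftarrow> pmf_of_set A; xs \<leftarrow> pmf_of_set (permutations_of_set (A - {x})); return_pmf (xs @ [x])}"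
\<comment> \<open>Reversal preserves the uniform law, so \<open>random_permutation_of_set\<close>,
  which splits off the first element, also yields a split at the last one.\<close>
proof -
  have rev: "pmf_of_set (permutations_of_set B) = map_pmf rev (pmf_of_set (permutations_of_set B))"
    if "finite B" for B :: "'a set"
    using that by (subst map_pmf_of_set_inj) auto
  have "pmf_of_set (permutations_of_set A) = map_pmf rev (pmf_of_set (permutations_of_set A))"
    using assms by (intro rev)
  also have "\<dots> = do {x \<leftarrow> pmf_of_set A;
      xs \<leftarrow> map_pmf rev (pmf_of_set (permutations_of_set (A - {x}))); return_pmf (xs @ [x])}"
    using assms by (subst random_permutation_of_set)
      (simp_all add: map_bind_pmf bind_map_pmf)
  also have "\<dots> = do {x \<leftarrow> pmf_of_set A;
      xs \<leftarrow> pmf_of_set (permutations_of_set (A - {x})); return_pmf (xs @ [x])}"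
    using assms by (subst rev[symmetric]) auto
  finally show ?thesis .
qed

definition commit ::
  "('l, 'r) hyperedge set \<Rightarrow> 'l \<Rightarrow> 'r set \<times> ('l, 'r) hyperedge set \<Rightarrow>
   'r set \<times> ('l, 'r) hyperedge set" where
  "commit M l s = (fst s - partners M l,
     if (l, partners M l) \<in> M then insert (l, partners M l) (snd s) else snd s)"

text \<open>One round of \<open>hg_rounds\<close> as a kernel on states. With the acceptance
  probability as a parameter, its effect can be computed for any state distribution.\<close>

definition hg_step ::
  "real \<Rightarrow> ('l, 'r) hyperedge set \<Rightarrow> 'l \<Rightarrow> 'r set \<times> ('l, 'r) hyperedge set \<Rightarrow>
   ('r set \<times> ('l, 'r) hyperedge set) pmf" where
  "hg_step p M l s =
     (if partners M l \<subseteq> fst s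
      then map_pmf (\<lambda>b. if b then commit M l s else s) (bernoulli_pmf p) else return_pmf s)"

lemma finite_set_pmf_hg_step [simp]: "finite (set_pmf (hg_step p M l s))"
  by (simp add: hg_step_def)

text \<open>
  Dividing by \<open>x\<close> cancels the probability that the hyperedge is available, so a functional \<open>g\<close> of
  the state grows by exactly \<open>a\<close> times its increment. It is applied with \<open>g\<close> the indicator of an
  occupied offline vertex and with \<open>g\<close> the weight of the matching.
\<close>

lemma expectation_hg_step:
  fixes g :: "'r set \<times> ('l, 'r) hyperedge set \<Rightarrow> real" and M l D
  defines "x \<equiv> measure_pmf.prob D {s. partners M l \<subseteq> fst s}"
  assumes fin: "finite (set_pmf D)" and a: "0 \<le> a" "a \<le> x"
    and g: "\<And>s. s \<in> set_pmf D \<Longrightarrow> partners M l \<subseteq> fst s \<Longrightarrow> g (commit M l s) = g s + c"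
  shows "measure_pmf.expectation (D \<bind> hg_step (a / x) M l) g =
    measure_pmf.expectation D g + a * c"
proof -
  \<comment> \<open>This keeps \<open>bernoulli_pmf\<close> from truncating. If
    \<open>x = 0\<close>, the quotient is 0, and \<open>a \<le> x\<close> forces
    \<open>a = 0\<close>, so the final cancellation still holds.\<close>
  have p: "0 \<le> a / x" "a / x \<le> 1"
    using a by (auto simp: divide_le_eq)
  have step: "measure_pmf.expectation (hg_step (a / x) M l s) g =
      g s + a / x * c * indicator {s. partners M l \<subseteq> fst s} s" if "s \<in> set_pmf D" for s
    using p g[OF that] by (auto simp: hg_step_def algebra_simps)
  have "measure_pmf.expectation (D \<bind> hg_step (a / x) M l) g =
      (\<Sum>s\<in>set_pmf D. pmf D s *\<^sub>R measure_pmf.expectation (hg_step (a / x) M l s) g)"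
    using fin by (intro pmf_expectation_bind) auto
  also have "\<dots> = (\<Sum>s\<in>set_pmf D. pmf D s *\<^sub>R
      (g s + a / x * c * indicator {s. partners M l \<subseteq> fst s} s))"
    by (intro sum.cong refl) (simp add: step)
  also have "\<dots> = measure_pmf.expectation D
      (\<lambda>s. g s + a / x * c * indicator {s. partners M l \<subseteq> fst s} s)"
    using fin by (intro integral_measure_pmf[symmetric]) auto
  also have "\<dots> = measure_pmf.expectation D g + a / x * c * x"
    using fin by (subst Bochner_Integration.integral_add)
      (auto simp: x_def integrable_measure_pmf_finite)
  also have "a / x * c * x = a * c"
    using a by (cases "x = 0") auto
  finally show ?thesis .
qed

text \<open>The first \<open>t\<close> rounds read only the first \<open>t\<close> arrivals.\<close>

lemma hg_rounds_append:
  "t \<le> length \<sigma> \<Longrightarrow> hg_rounds d m R E w t (\<sigma> @ \<tau>) = hg_rounds d m R E w t \<sigma>"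
  by (induction t) (auto simp: nth_append Let_def)

lemma finite_set_pmf_hg_rounds [simp]: "finite (set_pmf (hg_rounds d m R E w t \<sigma>))"
  by (induction t) (auto simp: Let_def)

text \<open>Union bound over the possibly occupied vertices of \<open>S\<close>;
  \<open>0 \<le> b\<close> covers sets with fewer than \<open>d\<close> elements.\<close>

lemma prob_available:
  assumes "finite S" "card S \<le> d" "0 \<le> b"
    and "\<And>r. r \<in> S \<Longrightarrow> measure_pmf.prob D {s. r \<notin> fst s} \<le> b"
  shows "1 - real d * b \<le> measure_pmf.prob D {s. S \<subseteq> fst s}"
proof -
  have "measure_pmf.prob D (- {s. S \<subseteq> fst s}) = measure_pmf.prob D (\<Union>r\<in>S. {s. r \<notin> fst s})"
    by (rule arg_cong[where f = "measure_pmf.prob D"]) auto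
  also have "\<dots> \<le> (\<Sum>r\<in>S. measure_pmf.prob D {s. r \<notin> fst s})"
    using assms(1) by (intro measure_pmf.finite_measure_subadditive_finite) auto
  also have "\<dots> \<le> (\<Sum>r\<in>S. b)"
    by (intro sum_mono assms(4))
  also have "\<dots> \<le> real d * b"
    using assms(2,3) by (simp add: mult_right_mono)
  finally show ?thesis
    using measure_pmf.prob_compl[of "{s. S \<subseteq> fst s}" D] by (simp add: Compl_eq_Diff_UNIV)
qed

section \<open>The state after a random order of a fixed set of arrivals\<close>

locale hg_analysis =
  fixes d m :: nat and L :: "'l set" and R :: "'r set"
    and E :: "('l, 'r) hyperedge set" and w :: "('l, 'r) hyperedge \<Rightarrow> real"
  assumes hypergraph: "bip_hypergraph d L R E w" and unique: "unique_optima L E w"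
    and d_le: "real d \<le> hg_threshold d * real m"
begin

lemma finite_L: "finite L"
  using hypergraph by (simp add: bip_hypergraph_def)

lemma finite_R: "finite R"
  using hypergraph by (simp add: bip_hypergraph_def)

lemma finite_E: "finite E"
proof (rule finite_subset)
  show "E \<subseteq> L \<times> Pow R"
    using hypergraph by (auto simp: bip_hypergraph_def)
qed (use finite_L finite_R in auto)

abbreviation opt :: "'l set \<Rightarrow> ('l, 'r) hyperedge set" where
  "opt L' \<equiv> opt_matching (restrict_edges E L') w"

abbreviation \<alpha> :: "nat \<Rightarrow> real" where
  "\<alpha> \<equiv> hg_alpha d m"

text \<open>For \<open>card L' = t\<close> this is the law in which \<open>hg_rounds\<close>
  computes \<open>x\<close>: the set of arrivals is fixed and only their order is random.
  \<open>m\<close> stays the total number of arrivals.\<close>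

definition run :: "nat \<Rightarrow> 'l set \<Rightarrow> ('r set \<times> ('l, 'r) hyperedge set) pmf" where
  "run t L' = pmf_of_set (permutations_of_set L') \<bind> hg_rounds d m R E w t"

lemma opt_max: "L' \<subseteq> L \<Longrightarrow> max_weight_matching (restrict_edges E L') w (opt L')"
  by (rule opt_matching_props[OF unique])

lemma matching_opt: "L' \<subseteq> L \<Longrightarrow> matching (restrict_edges E L') (opt L')"
  using opt_max by (simp add: max_weight_matching_def)

lemma opt_subset: "L' \<subseteq> L \<Longrightarrow> opt L' \<subseteq> E"
  using matching_opt by (auto simp: matching_def restrict_edges_def)

lemma partners_opt:
  assumes "L' \<subseteq> L"
  shows "partners (opt L') l \<subseteq> R" "card (partners (opt L') l) \<le> d"
proof -
  have "partners (opt L') l = {} \<or> (l, partners (opt L') l) \<in> E"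
    using in_partnersD[OF matching_opt[OF assms]] opt_subset[OF assms] by blast
  then show "partners (opt L') l \<subseteq> R" "card (partners (opt L') l) \<le> d"
    using hypergraph by (auto simp: bip_hypergraph_def)
qed

lemma finite_set_pmf_run [simp]: "L' \<subseteq> L \<Longrightarrow> finite (set_pmf (run t L'))"
  using finite_subset[OF _ finite_L] by (auto simp: run_def)

text \<open>\<open>hg_rounds_matching\<close> concerns orders of all of \<open>L\<close>, so an
  order of \<open>L'\<close> is extended by the remaining vertices; this leaves the first
  \<open>t\<close> rounds unchanged.\<close>

lemma run_matching:
  assumes "L' \<subseteq> L" "card L' = t" "(A, \<mu>) \<in> set_pmf (run t L')"
  shows "matching (restrict_edges E L') \<mu>"
proof -
  have fin: "finite L'"
    using assms(1) finite_L finite_subset by blast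
  then obtain \<sigma> where \<sigma>: "\<sigma> \<in> permutations_of_set L'" "(A, \<mu>) \<in> set_pmf (hg_rounds d m R E w t \<sigma>)"
    using assms(3) by (auto simp: run_def)
  obtain \<tau> where \<tau>: "set \<tau> = L - L'" "distinct \<tau>"
    using finite_distinct_list finite_L finite_Diff by metis
  have len: "length \<sigma> = t"
    using \<sigma>(1) assms(2) fin by (simp add: length_finite_permutations_of_set)
  have "(A, \<mu>) \<in> set_pmf (hg_rounds d m R E w t (\<sigma> @ \<tau>))"
    using \<sigma>(2) len by (simp add: hg_rounds_append)
  moreover have "distinct (\<sigma> @ \<tau>)" "set (\<sigma> @ \<tau>) = L"
    using \<sigma>(1) \<tau> assms(1) by (auto dest: permutations_of_setD)
  ultimately have "matching (restrict_edges E (set (take t (\<sigma> @ \<tau>)))) \<mu> \<and>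
      A = R - (\<Union>e\<in>\<mu>. snd e)"
    using len by (intro hg_rounds_matching[OF hypergraph unique]) auto
  then show ?thesis
    using len \<sigma>(1) by (auto dest: permutations_of_setD)
qed

text \<open>Condition on the last arrival \<open>l\<close>. The last hyperedge and \<open>x\<close>
  depend on the order only through \<open>l\<close> and the set \<open>L' - {l}\<close>, so
  averaging over the earlier orders gives \<open>run t (L' - {l})\<close>, the very law that defines
  \<open>x\<close>.\<close>

lemma run_Suc:
  assumes "L' \<subseteq> L" "card L' = Suc t"
  shows "run (Suc t) L' = pmf_of_set L' \<bind> (\<lambda>l.
    if Suc t \<le> hg_start d m then run t (L' - {l})
    else run t (L' - {l}) \<bind> hg_step (\<alpha> (Suc t) /
      measure_pmf.prob (run t (L' - {l})) {s. partners (opt L') l \<subseteq> fst s}) (opt L') l)"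
proof -
  have fin: "finite L'" "L' \<noteq> {}"
    using assms(2) card_gt_0_iff[of L'] by auto
  have early: "int (Suc t) \<le> \<lfloor>hg_threshold d * real m\<rfloor> \<longleftrightarrow> Suc t \<le> hg_start d m"
    unfolding hg_start_def by linarith
  have "run (Suc t) L' = pmf_of_set L' \<bind> (\<lambda>l. pmf_of_set (permutations_of_set (L' - {l})) \<bind>
      (\<lambda>\<sigma>. hg_rounds d m R E w (Suc t) (\<sigma> @ [l])))"
    unfolding run_def using fin
    by (subst random_permutation_of_set_snoc) (simp_all add: bind_assoc_pmf bind_return_pmf)
  also have "\<dots> = pmf_of_set L' \<bind> (\<lambda>l. pmf_of_set (permutations_of_set (L' - {l})) \<bind>
      (\<lambda>\<sigma>. if Suc t \<le> hg_start d m then hg_rounds d m R E w t \<sigma>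
        else hg_rounds d m R E w t \<sigma> \<bind> hg_step (\<alpha> (Suc t) /
          measure_pmf.prob (run t (L' - {l})) {s. partners (opt L') l \<subseteq> fst s}) (opt L') l))"
  proof (intro bind_pmf_cong refl)
    fix l \<sigma>
    assume "l \<in> set_pmf (pmf_of_set L')"
      and "\<sigma> \<in> set_pmf (pmf_of_set (permutations_of_set (L' - {l})))"
    then have l: "l \<in> L'" and \<sigma>: "\<sigma> \<in> permutations_of_set (L' - {l})"
      using fin by auto
    have len: "length \<sigma> = t"
      using l \<sigma> assms(2) fin by (simp add: length_finite_permutations_of_set)
    have set: "set (take (Suc t) (\<sigma> @ [l])) = L'" "set (take t (\<sigma> @ [l])) = L' - {l}"
      using \<sigma> l len by (auto dest: permutations_of_setD)
    have nth: "(\<sigma> @ [l]) ! t = l"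
      using len by (metis nth_append_length)
    show "hg_rounds d m R E w (Suc t) (\<sigma> @ [l]) =
      (if Suc t \<le> hg_start d m then hg_rounds d m R E w t \<sigma>
        else hg_rounds d m R E w t \<sigma> \<bind> hg_step (\<alpha> (Suc t) /
          measure_pmf.prob (run t (L' - {l})) {s. partners (opt L') l \<subseteq> fst s}) (opt L') l)"
      unfolding hg_rounds.simps early set nth Let_def case_prod_unfold prod.collapse run_def
        hg_step_def[abs_def] commit_def[abs_def] map_pmf_def
      by (simp add: len hg_rounds_append)
  qed
  also have "\<dots> = pmf_of_set L' \<bind> (\<lambda>l.
    if Suc t \<le> hg_start d m then run t (L' - {l})
    else run t (L' - {l}) \<bind> hg_step (\<alpha> (Suc t) /
      measure_pmf.prob (run t (L' - {l})) {s. partners (opt L') l \<subseteq> fst s}) (opt L') l)"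
    by (intro bind_pmf_cong refl) (simp add: run_def bind_assoc_pmf)
  finally show ?thesis .
qed

text \<open>Averages \<open>expectation_hg_step\<close> over the last arrival. Sampling rounds fit
  the same formula, because \<open>\<alpha>\<close> is 0 there.\<close>

lemma expectation_run_Suc:
  fixes g :: "'r set \<times> ('l, 'r) hyperedge set \<Rightarrow> real"
  assumes L': "L' \<subseteq> L" "card L' = Suc t"
    and x: "\<And>l. l \<in> L' \<Longrightarrow>
      \<alpha> (Suc t) \<le> measure_pmf.prob (run t (L' - {l})) {s. partners (opt L') l \<subseteq> fst s}"
    and g: "\<And>l s. l \<in> L' \<Longrightarrow> s \<in> set_pmf (run t (L' - {l})) \<Longrightarrow> partners (opt L') l \<subseteq> fst s \<Longrightarrow>
      g (commit (opt L') l s) = g s + c l"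
  shows "measure_pmf.expectation (run (Suc t) L') g =
    ((\<Sum>l\<in>L'. measure_pmf.expectation (run t (L' - {l})) g) + \<alpha> (Suc t) * (\<Sum>l\<in>L'. c l)) /
    real (Suc t)"
proof -
  have fin: "finite L'" "L' \<noteq> {}"
    using L'(2) card_gt_0_iff[of L'] by auto
  have sub: "L' - {l} \<subseteq> L" for l
    using L' by blast
  have "measure_pmf.expectation (run (Suc t) L') g =
      (\<Sum>l\<in>L'. (measure_pmf.expectation (run t (L' - {l})) g + \<alpha> (Suc t) * c l) /\<^sub>R real (card L'))"
    unfolding run_Suc[OF L']
  proof (subst pmf_expectation_bind_pmf_of_set, goal_cases)
    case 4
    show ?case
    proof (intro sum.cong refl arg_cong2[where f = scaleR])
      fix l assume l: "l \<in> L'"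
      show "measure_pmf.expectation (if Suc t \<le> hg_start d m then run t (L' - {l})
        else run t (L' - {l}) \<bind> hg_step (\<alpha> (Suc t) /
          measure_pmf.prob (run t (L' - {l})) {s. partners (opt L') l \<subseteq> fst s}) (opt L') l) g =
        measure_pmf.expectation (run t (L' - {l})) g + \<alpha> (Suc t) * c l"
      proof (cases "Suc t \<le> hg_start d m")
        case True
        then show ?thesis
          by (simp add: hg_alpha_early le_hg_start_iff del: of_nat_Suc)
      next
        case False
        then show ?thesis
          using expectation_hg_step[of "run t (L' - {l})" "\<alpha> (Suc t)" "opt L'" l g "c l"]
            x[OF l] g[OF l] sub hg_alpha_nonneg[OF d_le] by simp
      qed
    qed
  qed (use fin sub in auto)
  then show ?thesis
    by (simp only: L'(2) real_scaleR_def sum_distrib_left[symmetric] sum.distrib)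
      (simp add: divide_inverse mult.commute)
qed

text \<open>The recursion for \<open>\<alpha>\<close> is exactly what the union bound yields from
  the occupancy bound. That bound is a hypothesis here so that the induction for
  \<open>prob_occupied\<close> can supply its induction hypothesis.\<close>

lemma alpha_le_prob:
  assumes "L' \<subseteq> L" "S \<subseteq> R" "card S \<le> d"
    and occ: "\<And>r. r \<in> R \<Longrightarrow>
      measure_pmf.prob (run t L') {s. r \<notin> fst s} \<le> (\<Sum>i = 1..t. \<alpha> i / real i)"
  shows "\<alpha> (Suc t) \<le> measure_pmf.prob (run t L') {s. S \<subseteq> fst s}"
proof (cases "Suc t \<le> hg_start d m")
  case True
  then show ?thesis
    by (simp add: hg_alpha_early le_hg_start_iff del: of_nat_Suc)
next
  case False
  then have "hg_threshold d * real m < real (Suc t)"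
    by (simp flip: hg_start_less_iff del: of_nat_Suc)
  from hg_alpha_late[OF this] have "\<alpha> (Suc t) = 1 - real d * (\<Sum>i = 1..t. \<alpha> i / real i)"
    by (simp only: atLeastLessThanSuc_atLeastAtMost)
  also have "\<dots> \<le> measure_pmf.prob (run t L') {s. S \<subseteq> fst s}"
    using assms finite_subset[OF assms(2) finite_R]
    by (intro prob_available sum_nonneg divide_nonneg_nonneg hg_alpha_nonneg d_le occ) auto
  finally show ?thesis .
qed

text \<open>At most one vertex of \<open>L'\<close> has \<open>r\<close> among its partners in
  \<open>opt L'\<close>. It arrives last with probability at most \<open>1 / (t + 1)\<close> and is
  then accepted with probability \<open>\<alpha> (Suc t)\<close>.\<close>

lemma prob_occupied:
  assumes "L' \<subseteq> L" "card L' = t" "r \<in> R"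
  shows "measure_pmf.prob (run t L') {s. r \<notin> fst s} \<le> (\<Sum>i = 1..t. \<alpha> i / real i)"
  using assms
proof (induction t arbitrary: L' r)
  case 0
  then have "L' = {}"
    using finite_subset[OF _ finite_L] by auto
  then show ?case
    using 0 by (simp add: run_def pmf_of_set_singleton bind_return_pmf measure_return)
next
  case (Suc t)
  define B where "B = (\<Sum>i = 1..t. \<alpha> i / real i)"
  have fin: "finite L'"
    using Suc.prems finite_subset[OF _ finite_L] by auto
  have IH: "measure_pmf.prob (run t (L' - {l})) {s. r \<notin> fst s} \<le> B"
    if "l \<in> L'" "r \<in> R" for l r
    unfolding B_def using Suc.prems that fin by (intro Suc.IH) auto
  have M: "matching (restrict_edges E L') (opt L')"
    by (rule matching_opt[OF Suc.prems(1)])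
  have ex: "measure_pmf.expectation D (indicator {s. r \<notin> fst s}) =
      measure_pmf.prob D {s. r \<notin> fst s}"
    for D :: "('r set \<times> ('l, 'r) hyperedge set) pmf"
    by simp
  have one: "(\<Sum>l\<in>L'. indicator {l. r \<in> partners (opt L') l} l :: real) \<le> 1"
  proof -
    have "card (L' \<inter> {l. r \<in> partners (opt L') l}) \<le> Suc 0"
      using fin partners_disjoint[OF M] by (subst card_le_Suc0_iff_eq) auto
    then show ?thesis
      using fin by (simp add: indicator_def sum.If_cases)
  qed
  have "measure_pmf.expectation (run (Suc t) L') (indicator {s. r \<notin> fst s}) =
    ((\<Sum>l\<in>L'. measure_pmf.expectation (run t (L' - {l})) (indicator {s. r \<notin> fst s})) +
      \<alpha> (Suc t) * (\<Sum>l\<in>L'. indicator {l. r \<in> partners (opt L') l} l)) / real (Suc t)"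
  proof (intro expectation_run_Suc Suc.prems alpha_le_prob partners_opt)
    \<comment> \<open>The increment is exact: committing requires all partners to be free, so
      \<open>r\<close> cannot be counted twice.\<close>
    show "indicator {s. r \<notin> fst s} (commit (opt L') l s) =
        (indicator {s. r \<notin> fst s} s + indicator {l. r \<in> partners (opt L') l} l :: real)"
      if "partners (opt L') l \<subseteq> fst s" for l and s :: "'r set \<times> ('l, 'r) hyperedge set"
      using that by (auto simp: commit_def indicator_def)
  qed (use IH Suc.prems in \<open>auto simp: B_def\<close>)
  also have "\<dots> \<le> ((\<Sum>l\<in>L'. B) + \<alpha> (Suc t) * 1) / real (Suc t)"
    unfolding ex using IH Suc.prems one hg_alpha_nonneg[OF d_le]
    by (intro divide_right_mono add_mono sum_mono mult_left_mono) auto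
  also have "\<dots> = (\<Sum>i = 1..Suc t. \<alpha> i / real i)"
    using Suc.prems(2) by (simp add: B_def add_divide_distrib)
  finally show ?case
    unfolding ex .
qed

text \<open>Dropping the hyperedge at \<open>l\<close> from \<open>opt L'\<close> leaves a matching
  for \<open>L' - {l}\<close>. Each hyperedge is dropped for exactly one \<open>l\<close>, so the
  total loss is one copy of the optimum.\<close>

lemma sum_weight_opt_remove:
  assumes "L' \<subseteq> L"
  shows "(real (card L') - 1) * weight w (opt L') \<le> (\<Sum>l\<in>L'. weight w (opt (L' - {l})))"
proof -
  have fin: "finite L'" "finite (opt L')"
    using assms finite_subset[OF _ finite_L] finite_subset[OF opt_subset finite_E] by auto
  have M: "matching (restrict_edges E L') (opt L')"
    by (rule matching_opt[OF assms])
  have "(real (card L') - 1) * weight w (opt L') =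
      (\<Sum>l\<in>L'. weight w (opt L') - edge_weight w (opt L') l)"
    using sum_edge_weight[OF fin(1) M, of w] by (simp add: sum_subtractf algebra_simps)
  also have "\<dots> \<le> (\<Sum>l\<in>L'. weight w (opt (L' - {l})))"
  proof (rule sum_mono)
    fix l
    have "matching (restrict_edges E (L' - {l})) {e \<in> opt L'. fst e \<noteq> l}"
      using M by (auto simp: matching_def restrict_edges_def disjoint_family_on_def)
    moreover have "L' - {l} \<subseteq> L"
      using assms by blast
    ultimately have "weight w {e \<in> opt L'. fst e \<noteq> l} \<le> weight w (opt (L' - {l}))"
      using opt_max by (simp add: max_weight_matching_def)
    then show "weight w (opt L') - edge_weight w (opt L') l \<le> weight w (opt (L' - {l}))"
      by (simp add: weight_remove_vertex[OF fin(2) M])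
  qed
  finally show ?thesis .
qed

text \<open>The earlier rounds contribute by induction, with optima of \<open>L' - {l}\<close>
  averaged by \<open>sum_weight_opt_remove\<close>; the last round adds
  \<open>\<alpha> (Suc t)\<close> times the average weight of a vertex in
  \<open>opt L'\<close>.\<close>

lemma expected_weight:
  assumes "L' \<subseteq> L" "card L' = t"
  shows "(\<Sum>i = 1..t. \<alpha> i) / real t * weight w (opt L') \<le>
    measure_pmf.expectation (run t L') (\<lambda>s. weight w (snd s))"
  using assms
proof (induction t arbitrary: L')
  case 0
  then have "L' = {}"
    using finite_subset[OF _ finite_L] by auto
  then show ?case
    by (simp add: run_def pmf_of_set_singleton bind_return_pmf weight_def)
next
  case (Suc t)
  define B where "B = (\<Sum>i = 1..t. \<alpha> i) / real t"
  \<comment> \<open>For \<open>t = 0\<close> both sides of the equation are 0.\<close>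
  have B: "B * real t = (\<Sum>i = 1..t. \<alpha> i)" "0 \<le> B"
    unfolding B_def by (auto intro!: divide_nonneg_nonneg sum_nonneg hg_alpha_nonneg d_le)
  have fin: "finite L'"
    using Suc.prems finite_subset[OF _ finite_L] by auto
  have card: "card (L' - {l}) = t" if "l \<in> L'" for l
    using that Suc.prems fin by simp
  have sub: "L' - {l} \<subseteq> L" for l
    using Suc.prems by blast
  have M: "matching (restrict_edges E L') (opt L')"
    by (rule matching_opt[OF Suc.prems(1)])
  have step: "(\<Sum>i = 1..Suc t. \<alpha> i) = B * real t + \<alpha> (Suc t)"
    by (simp add: B(1))
  have "(\<Sum>i = 1..Suc t. \<alpha> i) / real (Suc t) * weight w (opt L') =
      (B * (real t * weight w (opt L')) + \<alpha> (Suc t) * weight w (opt L')) / real (Suc t)"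
    unfolding step by (simp add: algebra_simps)
  also have "\<dots> \<le> (B * (\<Sum>l\<in>L'. weight w (opt (L' - {l}))) + \<alpha> (Suc t) * weight w (opt L')) /
      real (Suc t)"
    using sum_weight_opt_remove[OF Suc.prems(1)] Suc.prems(2) B(2)
    by (intro divide_right_mono add_right_mono mult_left_mono) auto
  also have "\<dots> \<le> ((\<Sum>l\<in>L'. measure_pmf.expectation (run t (L' - {l})) (\<lambda>s. weight w (snd s))) +
      \<alpha> (Suc t) * (\<Sum>l\<in>L'. edge_weight w (opt L') l)) / real (Suc t)"
    unfolding sum_edge_weight[OF fin M] sum_distrib_left B_def
    using Suc.IH[OF sub card]
    by (intro divide_right_mono add_right_mono sum_mono) auto
  also have "\<dots> = measure_pmf.expectation (run (Suc t) L') (\<lambda>s. weight w (snd s))"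
  proof (intro expectation_run_Suc[symmetric] Suc.prems alpha_le_prob partners_opt sub prob_occupied card)
    fix l s
    assume l: "l \<in> L'" and s: "s \<in> set_pmf (run t (L' - {l}))"
    \<comment> \<open>The earlier matching has no hyperedge at \<open>l\<close>, so the insertion
      adds the full weight.\<close>
    have "matching (restrict_edges E (L' - {l})) (snd s)"
      using run_matching[OF sub card, of l "fst s" "snd s"] l s by simp
    then have "finite (snd s)" "(l, partners (opt L') l) \<notin> snd s"
      using finite_subset[OF _ finite_E, of "snd s"] by (auto simp: matching_def restrict_edges_def)
    then show "weight w (snd (commit (opt L') l s)) = weight w (snd s) + edge_weight w (opt L') l"
      by (simp add: commit_def edge_weight_def weight_def)
  qed
  finally show ?case .
qed

lemma expectation_hg:
  assumes "m = card L"
  shows "(\<Sum>i = 1..m. \<alpha> i) / real m * weight w (opt L) \<le>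
    measure_pmf.expectation (hg d L R E w) (weight w)"
proof -
  have "hg d L R E w = map_pmf snd (run m L)"
    unfolding hg_def run_def assms[symmetric] map_pmf_def
    by (simp add: bind_assoc_pmf case_prod_unfold bind_return_pmf)
  then show ?thesis
    using expected_weight[OF order_refl assms[symmetric]] by simp
qed

end

section \<open>The competitive ratio\<close>

lemma expectation_hg_nonneg:
  assumes "bip_hypergraph d L R E w" "unique_optima L E w"
  shows "0 \<le> measure_pmf.expectation (hg d L R E w) (weight w)"
proof (rule integral_nonneg_AE, subst AE_measure_pmf_iff, intro ballI)
  fix \<mu> assume "\<mu> \<in> set_pmf (hg d L R E w)"
  then have "matching E \<mu>"
    by (rule hg_matching[OF assms])
  then show "0 \<le> weight w \<mu>"
    using assms(1) by (auto simp: weight_def matching_def bip_hypergraph_def intro!: sum_nonneg)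
qed

theorem theorem14:
  fixes d :: nat
  assumes "d \<ge> 2"
  shows "\<exists>\<epsilon> :: nat \<Rightarrow> real. \<epsilon> \<longlonglongrightarrow> 0 \<and>
    (\<forall>(L :: 'l set) (R :: 'r set) E w \<mu>opt.
       bip_hypergraph d L R E w \<longrightarrow> unique_optima L E w \<longrightarrow> max_weight_matching E w \<mu>opt \<longrightarrow>
       measure_pmf.expectation (hg d L R E w) (weight w)
         \<ge> (1 - \<epsilon> (card L)) * (1 / real d powr (real d / (real d - 1))) * weight w \<mu>opt)"
proof -
  define c where "c = hg_threshold d / real d"
  have c: "0 < c"
    using hg_threshold_pos[OF assms] assms by (simp add: c_def)
  \<comment> \<open>For large \<open>m\<close> this makes \<open>(1 - \<epsilon> m) * c\<close>
    equal to \<open>hg_guarantee d m\<close>. For small \<open>m\<close> the value 1 reduces the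
    claim to nonnegativity of the expected weight. Only \<open>d\<close> and \<open>m\<close> enter,
    so the error is uniform over all instances.\<close>
  define \<epsilon> where
    "\<epsilon> = (\<lambda>m. if real d \<le> hg_threshold d * real m then 1 - hg_guarantee d m / c else 1)"
  have "(\<lambda>m. 1 - hg_guarantee d m / c) \<longlonglongrightarrow> 1 - c / c"
    using hg_guarantee_tendsto[OF assms] c assms by (intro tendsto_intros) (auto simp: c_def)
  moreover have "\<forall>\<^sub>F m in sequentially. real d \<le> hg_threshold d * real m"
    using hg_threshold_pos[OF assms] by real_asymp
  then have "\<forall>\<^sub>F m in sequentially. 1 - hg_guarantee d m / c = \<epsilon> m"
    by eventually_elim (simp add: \<epsilon>_def)
  ultimately have "\<epsilon> \<longlonglongrightarrow> 0"
    using c by (simp add: Lim_transform_eventually)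
  moreover have "(1 - \<epsilon> (card L)) * (1 / real d powr (real d / (real d - 1))) * weight w \<mu>opt \<le>
      measure_pmf.expectation (hg d L R E w) (weight w)"
    if H: "bip_hypergraph d L R E w" "unique_optima L E w" "max_weight_matching E w \<mu>opt"
    for L :: "'l set" and R :: "'r set" and E w \<mu>opt
  proof (cases "real d \<le> hg_threshold d * real (card L)")
    case True
    interpret hg_analysis d "card L" L R E w
      by unfold_locales (use H True in auto)
    have E: "restrict_edges E L = E"
      using H(1) by (auto simp: restrict_edges_def bip_hypergraph_def)
    have opt: "weight w \<mu>opt \<le> weight w (opt L)" "0 \<le> weight w \<mu>opt"
      using H opt_max[of L] unfolding E
      by (auto simp: max_weight_matching_def weight_def matching_def bip_hypergraph_def
          intro!: sum_nonneg)
    have "(1 - \<epsilon> (card L)) * (1 / real d powr (real d / (real d - 1))) * weight w \<mu>opt =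
        hg_guarantee d (card L) * weight w \<mu>opt"
      unfolding hg_ratio_eq[OF assms] c_def[symmetric] using True c by (simp add: \<epsilon>_def)
    also have "\<dots> \<le> (\<Sum>i = 1..card L. hg_alpha d (card L) i) / real (card L) * weight w \<mu>opt"
      by (intro mult_right_mono hg_guarantee_le assms True opt)
    also have "\<dots> \<le> (\<Sum>i = 1..card L. hg_alpha d (card L) i) / real (card L) * weight w (opt L)"
      by (intro mult_left_mono divide_nonneg_nonneg sum_nonneg hg_alpha_nonneg True opt) auto
    also have "\<dots> \<le> measure_pmf.expectation (hg d L R E w) (weight w)"
      by (rule expectation_hg) simp
    finally show ?thesis .
  next
    case False
    then show ?thesis
      using expectation_hg_nonneg[OF H(1,2)] by (simp add: \<epsilon>_def)
  qed
  ultimately show ?thesis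
    by blast
qed

end
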